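(* Let $G$ be a connected (finite or infinite) graph with finite maximum degree $\Delta(G)=\Delta$. Then $\operatorname{rl_p}(G)$ exists and $$\operatorname{rl_p}(G)\leq\left\lfloor\frac{(\Delta+1)^2}{4}\right\rfloor+1.$$
   Context: Graphs are simple and undirected and may be infinite; $d(\cdot,\cdot)$ denotes graph distance. The $k$-probe Robber Locating game on a graph $G$ (known to both players): a robber occupies a vertex of $G$, initially arbitrary and unknown to the cop. Cop and robber alternate turns, the cop first. At her turn the cop chooses a list $u_1,\ldots,u_k$ of (not necessarily distinct) vertices (all specified before any answer is received) and is then told the distances $d(v,u_1),\ldots,d(v,u_k)$, where $v$ is the robber's current location. If from this and all previous information she can deduce $v$, she wins. At his turn the robber may stay where he is or move to an adjacent vertex. $G$ is $k$-locatable if the cop has a deterministic strategy (each list of probes may depend on previous answers) which wins after finitely many turns against every possible starting vertex and sequence of moves of the robber. $\operatorname{rl_p}(G)$ is the minimum $k$ such that $G$ is $k$-locatable (if such $k$ exists). *)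

theory Defs
  imports Main
begin

text \<open>
  A graph is given by a vertex set \<open>V\<close>, finite or infinite, and an adjacency relation \<open>adj\<close>.
\<close>

definition simple_graph :: "'a set \<Rightarrow> ('a \<Rightarrow> 'a \<Rightarrow> bool) \<Rightarrow> bool" where
  "simple_graph V adj \<longleftrightarrow>
     (\<forall>u v. adj u v \<longrightarrow> u \<in> V \<and> v \<in> V) \<and>
     (\<forall>u v. adj u v \<longrightarrow> adj v u) \<and>
     (\<forall>u. \<not> adj u u)"

definition connected_graph :: "'a set \<Rightarrow> ('a \<Rightarrow> 'a \<Rightarrow> bool) \<Rightarrow> bool" where
  "connected_graph V adj \<longleftrightarrow>
     simple_graph V adj \<and> V \<noteq> {} \<and> (\<forall>u\<in>V. \<forall>v\<in>V. adj\<^sup>*\<^sup>* u v)"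

definition graph_degree :: "('a \<Rightarrow> 'a \<Rightarrow> bool) \<Rightarrow> 'a \<Rightarrow> nat" where
  "graph_degree adj v = card {w. adj v w}"

text \<open>
  Since \<open>card\<close> is \<open>0\<close> on infinite sets, finiteness of the neighbourhoods has to be required
  separately from boundedness of the degrees.
\<close>

definition finite_max_degree :: "'a set \<Rightarrow> ('a \<Rightarrow> 'a \<Rightarrow> bool) \<Rightarrow> bool" where
  "finite_max_degree V adj \<longleftrightarrow>
     (\<forall>v\<in>V. finite {w. adj v w}) \<and> finite (graph_degree adj ` V)"

definition max_degree :: "'a set \<Rightarrow> ('a \<Rightarrow> 'a \<Rightarrow> bool) \<Rightarrow> nat" where
  "max_degree V adj = Max (graph_degree adj ` V)"

text \<open>
  The length of a shortest walk; it is meaningful only for vertices joined by a walk, hence for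
  all pairs of vertices of a connected graph.
\<close>

definition graph_dist :: "('a \<Rightarrow> 'a \<Rightarrow> bool) \<Rightarrow> 'a \<Rightarrow> 'a \<Rightarrow> nat" where
  "graph_dist adj u v = (LEAST n. (adj ^^ n) u v)"

text \<open>
  A play of the robber is a sequence \<open>r\<close>, where \<open>r n\<close> is his location when the cop makes her
  probes number \<open>n\<close> (counting from \<open>0\<close>).
\<close>

definition robber_play :: "'a set \<Rightarrow> ('a \<Rightarrow> 'a \<Rightarrow> bool) \<Rightarrow> (nat \<Rightarrow> 'a) \<Rightarrow> bool" where
  "robber_play V adj r \<longleftrightarrow>
     r 0 \<in> V \<and> (\<forall>n. r (Suc n) = r n \<or> adj (r n) (r (Suc n)))"

text \<open>
  A deterministic strategy maps the list of all previous answers (oldest first; each answer is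
  itself a list of distances) to the next list of probes. The earlier probes need not be passed
  to it, as they are determined by the strategy and the earlier answers.
\<close>

definition cop_strategy :: "'a set \<Rightarrow> nat \<Rightarrow> (nat list list \<Rightarrow> 'a list) \<Rightarrow> bool" where
  "cop_strategy V k \<sigma> \<longleftrightarrow> (\<forall>h. length (\<sigma> h) = k \<and> set (\<sigma> h) \<subseteq> V)"

text \<open>The answers received by the cop during her first \<open>n\<close> turns.\<close>

primrec answers ::
  "('a \<Rightarrow> 'a \<Rightarrow> bool) \<Rightarrow> (nat list list \<Rightarrow> 'a list) \<Rightarrow> (nat \<Rightarrow> 'a) \<Rightarrow> nat \<Rightarrow> nat list list" where
  "answers adj \<sigma> r 0 = []"
| "answers adj \<sigma> r (Suc n) =
     answers adj \<sigma> r n @ [map (\<lambda>u. graph_dist adj (r n) u) (\<sigma> (answers adj \<sigma> r n))]"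

text \<open>
  After the answers to probes number \<open>n\<close> the cop can deduce the current location \<open>r n\<close>: every
  play of the robber consistent with all answers so far has the robber at \<open>r n\<close> now.
\<close>

definition located_at ::
  "'a set \<Rightarrow> ('a \<Rightarrow> 'a \<Rightarrow> bool) \<Rightarrow> (nat list list \<Rightarrow> 'a list) \<Rightarrow> (nat \<Rightarrow> 'a) \<Rightarrow> nat \<Rightarrow> bool" where
  "located_at V adj \<sigma> r n \<longleftrightarrow>
     (\<forall>r'. robber_play V adj r' \<and> answers adj \<sigma> r' (Suc n) = answers adj \<sigma> r (Suc n)
        \<longrightarrow> r' n = r n)"

definition locatable :: "nat \<Rightarrow> 'a set \<Rightarrow> ('a \<Rightarrow> 'a \<Rightarrow> bool) \<Rightarrow> bool" where
  "locatable k V adj \<longleftrightarrow>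
     (\<exists>\<sigma>. cop_strategy V k \<sigma> \<and>
        (\<forall>r. robber_play V adj r \<longrightarrow> (\<exists>n. located_at V adj \<sigma> r n)))"

definition rl_p :: "'a set \<Rightarrow> ('a \<Rightarrow> 'a \<Rightarrow> bool) \<Rightarrow> nat" where
  "rl_p V adj = (LEAST k. locatable k V adj)"

end

theory Submission
  imports Defs
begin

text \<open>
  The cop keeps a vertex \<open>x\<close>, a set \<open>A\<close> of neighbours of \<open>x\<close> and a number \<open>g\<close> such that, when she is
  about to probe, the robber is within distance \<open>g\<close> of some vertex of \<open>A\<close>. Write \<open>\<Delta>\<close> for the
  maximum degree and \<open>j\<close> for the size of \<open>A\<close>. She probes \<open>x\<close>, every \<open>y \<in> A\<close>, and for every
  \<open>y \<in> A\<close> enough neighbours of \<open>y\<close> other than \<open>x\<close> to leave at most \<open>j - 1\<close> of those unprobed; since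
  \<open>y\<close> has at most \<open>\<Delta> - 1\<close> neighbours besides \<open>x\<close>, probing \<open>\<Delta> - j\<close> of them is enough. This takes
  at most \<open>1 + j * (\<Delta> + 1 - j)\<close> probes, which by the inequality of arithmetic and geometric means is
  at most the claimed bound.

  If some probed vertex \<open>p\<close> turns out to be nearer than \<open>g\<close>, she continues from \<open>p\<close> with all
  neighbours of \<open>p\<close> and this smaller distance: unless the robber is at \<open>p\<close>, some neighbour of \<open>p\<close> is
  nearer still, and the robber's move undoes this gain at worst. Otherwise some \<open>y \<in> A\<close> is at distance
  exactly \<open>g\<close>. A shortest path to \<open>y\<close> arrives through a neighbour of \<open>y\<close> at distance \<open>g - 1\<close>; that
  neighbour was not probed, so it is one of at most \<open>j - 1\<close> vertices. She continues from \<open>y\<close> with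
  these and with the same \<open>g\<close>. The pair \<open>(g, j)\<close> thus decreases lexicographically every turn, until
  a probe hits the robber. A first probe of any vertex supplies an initial value of \<open>g\<close>, even in an
  infinite graph.

  The descent is lemma \<open>catchable_near_neighbours\<close>. It rests on \<open>catchable_step\<close>, which assembles
  a strategy from one round of probes and a strategy for each possible answer, so that no
  bookkeeping of states along histories is necessary.
\<close>

section \<open>Distances\<close>

lemma relpowp_graph_dist:
  assumes "connected_graph V adj" "u \<in> V" "v \<in> V"
  shows "(adj ^^ graph_dist adj u v) u v"
proof -
  have "\<exists>n. (adj ^^ n) u v"
    using assms by (intro rtranclp_imp_relpowp) (simp add: connected_graph_def)
  then show ?thesis
    unfolding graph_dist_def by (rule LeastI_ex)
qed

lemma graph_dist_le: "(adj ^^ n) u v \<Longrightarrow> graph_dist adj u v \<le> n"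
  unfolding graph_dist_def by (rule Least_le)

lemma graph_dist_eq_0_iff:
  assumes "connected_graph V adj" "u \<in> V" "v \<in> V"
  shows "graph_dist adj u v = 0 \<longleftrightarrow> u = v"
  using relpowp_graph_dist[OF assms] graph_dist_le[of 0 adj u v] by auto

lemma adj_in_vertices:
  assumes "connected_graph V adj" "adj u v"
  shows "u \<in> V" "v \<in> V"
  using assms by (auto simp: connected_graph_def simple_graph_def)

lemma adj_sym:
  assumes "connected_graph V adj" "adj u v"
  shows "adj v u"
  using assms by (auto simp: connected_graph_def simple_graph_def)

lemma graph_dist_move_le:
  assumes G: "connected_graph V adj" and V: "v \<in> V" "y \<in> V"
    and move: "w = v \<or> adj v w"
  shows "graph_dist adj w y \<le> Suc (graph_dist adj v y)"
  using move
proof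
  assume "adj v w"
  then have "(adj ^^ Suc (graph_dist adj v y)) w y"
    using adj_sym[OF G] relpowp_graph_dist[OF G V] by (blast intro: relpowp_Suc_I2)
  then show ?thesis
    by (rule graph_dist_le)
qed simp

lemma nearer_neighbour:
  assumes G: "connected_graph V adj" and V: "v \<in> V" "y \<in> V" and "v \<noteq> y"
  obtains z where "adj y z" "graph_dist adj v z < graph_dist adj v y"
proof -
  obtain m where m: "graph_dist adj v y = Suc m"
    using graph_dist_eq_0_iff[OF G V] \<open>v \<noteq> y\<close> by (cases "graph_dist adj v y") auto
  then have "(adj ^^ Suc m) v y"
    using relpowp_graph_dist[OF G V] by metis
  then obtain z where "(adj ^^ m) v z" "adj z y"
    by (rule relpowp_Suc_E)
  then show thesis
    using that adj_sym[OF G] graph_dist_le m by (metis less_Suc_eq_le)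
qed

text \<open>
  A robber who is not at \<open>y\<close> is nearer to some neighbour of \<open>y\<close>, and by moving he at most restores
  the distance that he had to \<open>y\<close>. This is how the cop shifts her reference vertex without losing ground.
\<close>

lemma neighbour_near_after_move:
  assumes G: "connected_graph V adj" and V: "v \<in> V" "y \<in> V" and "v \<noteq> y"
    and move: "w = v \<or> adj v w"
  obtains z where "adj y z" "graph_dist adj v z < graph_dist adj v y"
    "graph_dist adj w z \<le> graph_dist adj v y"
proof -
  obtain z where z: "adj y z" "graph_dist adj v z < graph_dist adj v y"
    using nearer_neighbour[OF G V \<open>v \<noteq> y\<close>] by blast
  moreover have "graph_dist adj w z \<le> Suc (graph_dist adj v z)"
    using graph_dist_move_le[OF G V(1) adj_in_vertices(2)[OF G z(1)] move] .
  ultimately show thesis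
    using that by simp
qed

section \<open>Strategies that hit the robber\<close>

lemma robber_play_in_vertices:
  assumes "connected_graph V adj" "robber_play V adj r"
  shows "r n \<in> V"
  using assms by (induction n) (auto simp: robber_play_def dest: adj_in_vertices, metis adj_in_vertices(2))

text \<open>
  Winning is sharpened here to probing the very vertex where the robber is. Unlike deducing
  his location, this depends on the present play alone and not on the other plays that fit the answers,
  so it is unaffected by forgetting part of the past.
\<close>

definition catchable :: "nat \<Rightarrow> 'a set \<Rightarrow> ('a \<Rightarrow> 'a \<Rightarrow> bool) \<Rightarrow> 'a set \<Rightarrow> bool" where
  "catchable k V adj C \<longleftrightarrow>
     (\<exists>\<sigma>. cop_strategy V k \<sigma> \<and>
        (\<forall>r. robber_play V adj r \<and> r 0 \<in> C \<longrightarrow> (\<exists>n. r n \<in> set (\<sigma> (answers adj \<sigma> r n)))))"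

lemma catchable_mono: "catchable k V adj D \<Longrightarrow> C \<subseteq> D \<Longrightarrow> catchable k V adj C"
  unfolding catchable_def by blast

text \<open>
  A probe of the robber's location returns distance \<open>0\<close>, and no other vertex returns \<open>0\<close> there.
\<close>

lemma catchable_imp_locatable:
  assumes G: "connected_graph V adj" and "catchable k V adj V"
  shows "locatable k V adj"
proof -
  obtain \<sigma> where \<sigma>: "cop_strategy V k \<sigma>"
    and catch: "\<And>r. robber_play V adj r \<Longrightarrow> \<exists>n. r n \<in> set (\<sigma> (answers adj \<sigma> r n))"
    using assms(2) by (auto simp: catchable_def robber_play_def)
  have "\<exists>n. located_at V adj \<sigma> r n" if r: "robber_play V adj r" for r
  proof -
    obtain n where n: "r n \<in> set (\<sigma> (answers adj \<sigma> r n))"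
      using catch[OF r] by blast
    have "r' n = r n"
      if r': "robber_play V adj r'" and eq: "answers adj \<sigma> r' (Suc n) = answers adj \<sigma> r (Suc n)" for r'
    proof -
      have "map (graph_dist adj (r' n)) (\<sigma> (answers adj \<sigma> r n)) =
          map (graph_dist adj (r n)) (\<sigma> (answers adj \<sigma> r n))"
        using eq by auto
      then have "graph_dist adj (r' n) (r n) = graph_dist adj (r n) (r n)"
        using n by (simp only: map_eq_conv)
      then show ?thesis
        using graph_dist_eq_0_iff[OF G] robber_play_in_vertices[OF G] r r' by metis
    qed
    then show ?thesis
      by (auto simp: located_at_def)
  qed
  then show ?thesis
    using \<sigma> by (auto simp: locatable_def)
qed

lemma list_with_set_and_length:
  assumes "finite P" "P \<noteq> {}" "card P \<le> k"
  obtains us where "set us = P" "length us = k"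
proof -
  obtain xs where xs: "set xs = P" "distinct xs"
    using finite_distinct_list[OF assms(1)] by blast
  let ?us = "xs @ replicate (k - length xs) (hd xs)"
  have "xs \<noteq> []"
    using xs assms(2) by auto
  then have "set ?us = P"
    using xs by auto
  moreover have "length ?us = k"
    using xs assms(3) distinct_card[of xs] by simp
  ultimately show thesis
    using that by blast
qed

lemma answers_Suc_shift:
  assumes "a = map (graph_dist adj (r 0)) (\<sigma> [])" and "\<And>h. \<sigma> (a # h) = \<tau> h"
  shows "answers adj \<sigma> r (Suc n) = a # answers adj \<tau> (r \<circ> Suc) n"
proof (induction n)
  case 0
  show ?case
    by (simp add: assms(1))
next
  case (Suc n)
  then show ?case
    using assms(2) by (simp only: answers.simps append_Cons comp_apply)
qed

text \<open>
  One round of the game: if the probes \<open>P\<close> miss a robber who is at \<open>v0\<close>, the cop cannot tell \<open>v0\<close> from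
  the vertices \<open>v\<close> with the same distances to \<open>P\<close>, so at her next turn he may be at any of these or
  at a neighbour. A strategy against each of these possibilities gives a strategy against all of them.
\<close>

lemma catchable_step:
  assumes G: "connected_graph V adj"
    and P: "finite P" "P \<subseteq> V" "P \<noteq> {}" "card P \<le> k"
    and next_turn: "\<And>v0. v0 \<in> C \<Longrightarrow> v0 \<in> V \<Longrightarrow> v0 \<notin> P \<Longrightarrow>
      catchable k V adj
        {w. \<exists>v\<in>C \<inter> V. (\<forall>p\<in>P. graph_dist adj v p = graph_dist adj v0 p) \<and> (w = v \<or> adj v w)}"
  shows "catchable k V adj C"
proof -
  obtain us where us: "set us = P" "length us = k"
    using list_with_set_and_length[OF P(1,3,4)] by blast
  define ans where "ans v = map (graph_dist adj v) us" for v
  define after where "after a = {w. \<exists>v\<in>C \<inter> V. ans v = a \<and> (w = v \<or> adj v w)}" for a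
  have after_catchable: "catchable k V adj (after (ans v0))" if "v0 \<in> C" "v0 \<in> V" "v0 \<notin> P" for v0
    using next_turn[OF that] us(1) by (simp add: after_def ans_def)
  define wins where "wins a \<tau> \<longleftrightarrow> cop_strategy V k \<tau> \<and>
      (\<forall>r. robber_play V adj r \<and> r 0 \<in> after a \<longrightarrow> (\<exists>n. r n \<in> set (\<tau> (answers adj \<tau> r n))))"
    for a \<tau>
  \<comment> \<open>Answers that cannot occur still need some legal continuation, as strategies are total.\<close>
  define \<tau> where "\<tau> a = (if \<exists>t. wins a t then SOME t. wins a t else (\<lambda>_. us))" for a
  define \<sigma> where "\<sigma> h = (case h of [] \<Rightarrow> us | a # h' \<Rightarrow> \<tau> a h')" for h
  have \<tau>_wins: "wins a (\<tau> a)" if "\<exists>t. wins a t" for a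
    using someI_ex[OF that] that by (simp add: \<tau>_def)
  have "cop_strategy V k (\<lambda>_. us)"
    using us P(2) by (simp add: cop_strategy_def)
  then have "cop_strategy V k (\<tau> a)" for a
  proof (cases "\<exists>t. wins a t")
    case True
    then show ?thesis
      using \<tau>_wins[OF True] by (simp add: wins_def)
  qed (simp add: \<tau>_def)
  then have "cop_strategy V k \<sigma>"
    using us P(2) by (auto simp: cop_strategy_def \<sigma>_def split: list.split)
  moreover have "\<exists>n. r n \<in> set (\<sigma> (answers adj \<sigma> r n))"
    if r: "robber_play V adj r" "r 0 \<in> C" for r
  proof (cases "r 0 \<in> P")
    case True
    then have "r 0 \<in> set (\<sigma> (answers adj \<sigma> r 0))"
      using us by (simp add: \<sigma>_def)
    then show ?thesis ..
  next
    case False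
    let ?a = "ans (r 0)" and ?r = "r \<circ> Suc"
    have r0: "r 0 \<in> V"
      using r by (simp add: robber_play_def)
    have "\<exists>t. wins ?a t"
      using after_catchable[OF r(2) r0 False] by (simp add: catchable_def wins_def)
    then have "wins ?a (\<tau> ?a)"
      by (rule \<tau>_wins)
    moreover have "robber_play V adj ?r"
      using r robber_play_in_vertices[OF G r(1), of 1] by (simp add: robber_play_def)
    moreover have "?r 0 \<in> after ?a"
      using r r0 by (auto simp: after_def robber_play_def)
    ultimately obtain n where n: "?r n \<in> set (\<tau> ?a (answers adj (\<tau> ?a) ?r n))"
      unfolding wins_def by blast
    have "answers adj \<sigma> r (Suc n) = ?a # answers adj (\<tau> ?a) ?r n"
      using answers_Suc_shift[of ?a adj r \<sigma> "\<tau> ?a" n] by (simp add: \<sigma>_def ans_def)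
    then have "r (Suc n) \<in> set (\<sigma> (answers adj \<sigma> r (Suc n)))"
      using n by (simp add: \<sigma>_def)
    then show ?thesis ..
  qed
  ultimately show ?thesis
    unfolding catchable_def by blast
qed

section \<open>The descent\<close>

lemma mult_diff_le_square_div_4: "j * (n - j) \<le> n\<^sup>2 div 4" for j n :: nat
proof (cases "j \<le> n")
  case True
  then obtain m where n: "n = j + m"
    using le_Suc_ex by blast
  have "2 * (j * m) \<le> j\<^sup>2 + m\<^sup>2"
  proof (cases "j \<le> m")
    case True
    then obtain d where "m = j + d"
      using le_Suc_ex by blast
    then show ?thesis
      by (simp add: power2_eq_square algebra_simps)
  next
    case False
    then obtain d where "j = m + d"
      using le_Suc_ex nat_le_linear by blast
    then show ?thesis
      by (simp add: power2_eq_square algebra_simps)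
  qed
  then have "j * m * 4 \<le> n\<^sup>2"
    by (simp add: n power2_eq_square algebra_simps)
  then show ?thesis
    by (simp add: n less_eq_div_iff_mult_less_eq)
qed simp

lemma subset_leaving_few:
  assumes "finite M" "card M \<le> b + c"
  obtains B where "B \<subseteq> M" "card B \<le> b" "card (M - B) \<le> c"
proof -
  obtain B where B: "B \<subseteq> M" "card B = min b (card M)"
    using obtain_subset_with_card_n[of "min b (card M)" M] by auto
  then have "card (M - B) = card M - min b (card M)"
    using assms(1) by (simp add: card_Diff_subset finite_subset)
  then show thesis
    using that B assms(2) by fastforce
qed

text \<open>
  The probes of one turn. Including \<open>x\<close> once, rather than among the neighbours chosen for
  each \<open>y\<close>, is what makes the bound sharp enough: the robber who heads back to \<open>x\<close> is noticed for every
  \<open>y\<close> at the price of a single probe.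
\<close>

lemma probe_set:
  assumes G: "connected_graph V adj"
    and deg: "\<And>v. v \<in> V \<Longrightarrow> finite {w. adj v w} \<and> card {w. adj v w} \<le> \<Delta>"
    and x: "x \<in> V" and A: "A \<subseteq> {w. adj x w}"
  obtains P where "finite P" "P \<subseteq> V" "insert x A \<subseteq> P" "card P \<le> (\<Delta> + 1)\<^sup>2 div 4 + 1"
    "\<And>y. y \<in> A \<Longrightarrow> card ({z. adj y z} - P) < card A"
proof -
  let ?j = "card A"
  have finA: "finite A" and j: "?j \<le> \<Delta>"
    using deg[OF x] A by (auto intro: finite_subset dest: card_mono)
  have "\<exists>B. B \<subseteq> {z. adj y z} \<and> card B \<le> \<Delta> - ?j \<and> card ({z. adj y z} - {x} - B) < ?j"
    if y: "y \<in> A" for y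
  proof -
    have "y \<in> V" and yx: "x \<in> {z. adj y z}"
      using A y adj_in_vertices[OF G] adj_sym[OF G] by auto
    note d = deg[OF this(1)]
    have pos: "0 < ?j"
      using y finA card_gt_0_iff by blast
    have "card ({z. adj y z} - {x}) = card {z. adj y z} - 1"
      using yx by (rule card_Diff_singleton)
    also have "\<dots> \<le> \<Delta> - 1"
      using d by (blast intro: diff_le_mono)
    also have "\<dots> = (\<Delta> - ?j) + (?j - 1)"
      using j pos by simp
    finally have few: "card ({z. adj y z} - {x}) \<le> (\<Delta> - ?j) + (?j - 1)" .
    have "finite ({z. adj y z} - {x})"
      using d by simp
    then obtain B where "B \<subseteq> {z. adj y z} - {x}" "card B \<le> \<Delta> - ?j"
      "card ({z. adj y z} - {x} - B) \<le> ?j - 1"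
      using few by (rule subset_leaving_few)
    then have "B \<subseteq> {z. adj y z} \<and> card B \<le> \<Delta> - ?j \<and> card ({z. adj y z} - {x} - B) < ?j"
      using pos by auto
    then show ?thesis ..
  qed
  then obtain B where B: "\<And>y. y \<in> A \<Longrightarrow> B y \<subseteq> {z. adj y z}"
    and card_B: "\<And>y. y \<in> A \<Longrightarrow> card (B y) \<le> \<Delta> - ?j"
    and card_rest: "\<And>y. y \<in> A \<Longrightarrow> card ({z. adj y z} - {x} - B y) < ?j"
    by metis
  have AV: "A \<subseteq> V"
    using A adj_in_vertices[OF G] by blast
  have finB: "finite (B y)" if "y \<in> A" for y
    using finite_subset[OF B[OF that]] deg[of y] AV that by blast
  define P where "P = insert x (\<Union>y\<in>A. insert y (B y))"
  show thesis
  proof (rule that)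
    show "finite P"
      using finA finB by (simp add: P_def)
    show "P \<subseteq> V"
      using x AV B adj_in_vertices(2)[OF G] unfolding P_def by blast
    show "insert x A \<subseteq> P"
      by (auto simp: P_def)
    have "card (\<Union>y\<in>A. insert y (B y)) \<le> (\<Sum>y\<in>A. card (insert y (B y)))"
      using finA by (rule card_UN_le)
    moreover have "card (insert y (B y)) \<le> \<Delta> + 1 - ?j" if "y \<in> A" for y
      using card_B[OF that] j by (intro card_insert_le_m1) simp_all
    then have "(\<Sum>y\<in>A. card (insert y (B y))) \<le> ?j * (\<Delta> + 1 - ?j)"
      using sum_bounded_above[of A "\<lambda>y. card (insert y (B y))" "\<Delta> + 1 - ?j"] by simp
    ultimately have "card P \<le> Suc (?j * (\<Delta> + 1 - ?j))"
      unfolding P_def using finA finB by (simp add: card_insert_if)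
    then show "card P \<le> (\<Delta> + 1)\<^sup>2 div 4 + 1"
      using mult_diff_le_square_div_4[of ?j "\<Delta> + 1"] by linarith
    show "card ({z. adj y z} - P) < ?j" if y: "y \<in> A" for y
    proof -
      have "{z. adj y z} - P \<subseteq> {z. adj y z} - {x} - B y"
        using y by (auto simp: P_def)
      moreover have "finite ({z. adj y z} - {x} - B y)"
        using deg AV y by blast
      ultimately show ?thesis
        using card_rest[OF y] by (blast intro: le_less_trans[OF card_mono])
    qed
  qed
qed

text \<open>
  Lexicographic descent on \<open>(g, card A)\<close>. It has no separate base case: for \<open>g = 0\<close> or empty
  \<open>A\<close> no possible location of the robber escapes the probes.
\<close>

lemma catchable_near_neighbours:
  assumes G: "connected_graph V adj"
    and deg: "\<And>v. v \<in> V \<Longrightarrow> finite {w. adj v w} \<and> card {w. adj v w} \<le> \<Delta>"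
    and "x \<in> V" "A \<subseteq> {w. adj x w}"
  shows "catchable ((\<Delta> + 1)\<^sup>2 div 4 + 1) V adj {w. \<exists>y\<in>A. graph_dist adj w y \<le> g}"
  using assms(3,4)
proof (induction "(g, card A)" arbitrary: g x A rule: wf_induct_rule[OF wf_lex_prod[OF wf_less_than wf_less_than]])
  case 1
  note x = \<open>x \<in> V\<close> and A = \<open>A \<subseteq> {w. adj x w}\<close>
  let ?d = "graph_dist adj" and ?k = "(\<Delta> + 1)\<^sup>2 div 4 + 1"
  have IH: "catchable ?k V adj {w. \<exists>y\<in>A'. ?d w y \<le> g'}"
    if "g' < g \<or> g' = g \<and> card A' < card A" "x' \<in> V" "A' \<subseteq> {w. adj x' w}" for g' x' A'
    using 1(1)[of g' A' x'] that by auto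
  obtain P where P: "finite P" "P \<subseteq> V" "insert x A \<subseteq> P" "card P \<le> ?k"
    and few: "\<And>y. y \<in> A \<Longrightarrow> card ({z. adj y z} - P) < card A"
    using probe_set[OF G deg x A] by blast
  show ?case
  proof (rule catchable_step[OF G P(1,2) _ P(4)])
    show "P \<noteq> {}"
      using P(3) by blast
    fix v0
    assume v0: "v0 \<in> {w. \<exists>y\<in>A. ?d w y \<le> g}" "v0 \<in> V" "v0 \<notin> P"
    let ?C = "{w. \<exists>y\<in>A. ?d w y \<le> g}"
    let ?C' = "{w. \<exists>v\<in>?C \<inter> V. (\<forall>p\<in>P. ?d v p = ?d v0 p) \<and> (w = v \<or> adj v w)}"
    have approach: "\<exists>z. adj p z \<and> ?d v z < ?d v0 p \<and> ?d w z \<le> ?d v0 p"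
      if p: "p \<in> P" and v: "v \<in> V" "\<forall>p\<in>P. ?d v p = ?d v0 p" and w: "w = v \<or> adj v w" for p v w
    proof -
      have pV: "p \<in> V"
        using p P(2) by blast
      have "?d v p \<noteq> 0"
        using v p v0(3) graph_dist_eq_0_iff[OF G v0(2) pV] by auto
      then have "v \<noteq> p"
        using graph_dist_eq_0_iff[OF G v(1) pV] by simp
      then obtain z where "adj p z" "?d v z < ?d v p" "?d w z \<le> ?d v p"
        using neighbour_near_after_move[OF G v(1) pV _ w] by blast
      then show ?thesis
        using v(2) p by auto
    qed
    show "catchable ?k V adj ?C'"
    proof (cases "\<exists>p\<in>P. ?d v0 p < g")
      case True
      then obtain p where p: "p \<in> P" "?d v0 p < g" by blast
      have "?C' \<subseteq> {w. \<exists>z\<in>{z. adj p z}. ?d w z \<le> ?d v0 p}"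
        using approach[OF p(1)] by blast
      then show ?thesis
        using IH[of "?d v0 p" "{z. adj p z}" p] p P(2) by (blast intro: catchable_mono)
    next
      case False
      obtain y where y: "y \<in> A" "?d v0 y \<le> g"
        using v0(1) by blast
      with False P(3) have yP: "y \<in> P" and dy: "?d v0 y = g"
        by force+
      have "?C' \<subseteq> {w. \<exists>z\<in>{z. adj y z} - P. ?d w z \<le> g}"
      proof
        fix w
        assume "w \<in> ?C'"
        then obtain v where v: "v \<in> V" "\<forall>p\<in>P. ?d v p = ?d v0 p" "w = v \<or> adj v w"
          by blast
        then obtain z where z: "adj y z" "?d v z < g" "?d w z \<le> g"
          using approach[OF yP] dy by blast
        moreover have "z \<notin> P"
          using False v(2) z(2) by auto
        ultimately show "w \<in> {w. \<exists>z\<in>{z. adj y z} - P. ?d w z \<le> g}"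
          by blast
      qed
      then show ?thesis
        using IH[of g "{z. adj y z} - P" y] few[OF y(1)] yP P(2) by (blast intro: catchable_mono)
    qed
  qed
qed

theorem theorem9:
  fixes V :: "'a set" and adj :: "'a \<Rightarrow> 'a \<Rightarrow> bool"
  assumes "connected_graph V adj"
    and "finite_max_degree V adj"
  shows "(\<exists>k. locatable k V adj) \<and> rl_p V adj \<le> (max_degree V adj + 1)\<^sup>2 div 4 + 1"
proof -
  let ?\<Delta> = "max_degree V adj" and ?d = "graph_dist adj"
  let ?k = "(?\<Delta> + 1)\<^sup>2 div 4 + 1"
  note G = assms(1)
  have deg: "finite {w. adj v w} \<and> card {w. adj v w} \<le> ?\<Delta>" if "v \<in> V" for v
    using assms(2) that Max_ge[of "graph_degree adj ` V" "graph_degree adj v"]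
    by (auto simp: finite_max_degree_def max_degree_def graph_degree_def)
  obtain u where u: "u \<in> V"
    using G by (auto simp: connected_graph_def)
  have "catchable ?k V adj V"
  proof (rule catchable_step[OF G, of "{u}"])
    fix v0
    assume v0: "v0 \<in> V" "v0 \<notin> {u}"
    let ?C = "{w. \<exists>v\<in>V \<inter> V. (\<forall>p\<in>{u}. ?d v p = ?d v0 p) \<and> (w = v \<or> adj v w)}"
    have "?C \<subseteq> {w. \<exists>z\<in>{z. adj u z}. ?d w z \<le> ?d v0 u}"
    proof
      fix w
      assume "w \<in> ?C"
      then obtain v where v: "v \<in> V" "?d v u = ?d v0 u" "w = v \<or> adj v w"
        by auto
      then have "v \<noteq> u"
        using v0 u graph_dist_eq_0_iff[OF G] by (metis singletonI)
      then obtain z where "adj u z" "?d w z \<le> ?d v u"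
        using neighbour_near_after_move[OF G v(1) u _ v(3)] by blast
      then show "w \<in> {w. \<exists>z\<in>{z. adj u z}. ?d w z \<le> ?d v0 u}"
        using v(2) by auto
    qed
    then show "catchable ?k V adj ?C"
      using catchable_near_neighbours[OF G deg u order.refl] by (blast intro: catchable_mono)
  qed (use u in auto)
  then have "locatable ?k V adj"
    by (rule catchable_imp_locatable[OF G])
  then show ?thesis
    unfolding rl_p_def by (blast intro: Least_le)
qed

end
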